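(* Let $-1<q<1$. For every integer $n\ge0$ there exist a symmetric function $A_n(\mathbf a^{(n)},q)$ of $\mathbf a^{(n)}=(a_1,\ldots,a_n)$ and a sequence $\{T_j^{(n)}(\mathbf a^{(n)},q)\}_{j\ge0}$ of symmetric functions of $\mathbf a^{(n)}$ such that for all real $a_1,\ldots,a_n$ with $|a_k|<1$, $k=1,\ldots,n$, and all $x$ with $|x|\le1$, $$g_n(x|\mathbf a^{(n)},q)=A_n(\mathbf a^{(n)},q)\,f_h(x|q)\sum_{j\ge0}\frac{T_j^{(n)}(\mathbf a^{(n)},q)}{(q)_j}\,h_j(x|q).$$ Moreover, $$\sum_{j\ge0}\left(T_j^{(n)}(\mathbf a^{(n)},q)\right)^2<\infty.$$
   Context: Notation: $(a)_\infty=\prod_{j\ge 0}(1-aq^j)$, $(q)_n=\prod_{j=1}^n(1-q^j)$, $(q)_\infty=\prod_{j\ge1}(1-q^j)$. The continuous $q$-Hermite polynomials $h_n(x|q)$ are given by $h_{-1}=0$, $h_0=1$, $h_{n+1}(x|q)=2x\,h_n(x|q)-(1-q^n)h_{n-1}(x|q)$. Their orthogonalizing density on $[-1,1]$ is $$f_h(x|q)=\frac{2(q)_\infty\sqrt{1-x^2}}{\pi}\prod_{k=1}^\infty l(x|q^k),\qquad l(x|a)=(1+a)^2-4ax^2,$$ and their generating function is, for $|t|<1$, $$\varphi_h(x|t,q)=\sum_{j\ge0}\frac{t^j}{(q)_j}h_j(x|q)=\frac{1}{\prod_{k=0}^\infty (1-2tq^kx+t^2q^{2k})}.$$ For $n\ge0$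 and $\mathbf a^{(n)}=(a_1,\ldots,a_n)$, $$g_n(x|\mathbf a^{(n)},q)=f_h(x|q)\prod_{j=1}^n\varphi_h(x|a_j,q),\qquad x\in[-1,1]$$ (empty product equal to $1$ when $n=0$). *)

theory Defs
  imports "HOL-Analysis.Analysis" "HOL-Combinatorics.Permutations"
begin

definition qfac :: "real \<Rightarrow> nat \<Rightarrow> real" where
  "qfac q n = (\<Prod>j=1..n. 1 - q ^ j)"

definition qfac_inf :: "real \<Rightarrow> real" where
  "qfac_inf q = (\<Prod>k. 1 - q ^ Suc k)"

text \<open>
  Continuous \<open>q\<close>-Hermite polynomials, as functions of \<open>x\<close>. The second equation is the
  three-term recurrence for \<open>n = 0\<close> with \<open>h\<close> of index \<open>-1\<close> equal to \<open>0\<close>.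
\<close>
fun qherm :: "real \<Rightarrow> nat \<Rightarrow> real \<Rightarrow> real" where
  "qherm q 0 x = 1"
| "qherm q (Suc 0) x = 2 * x"
| "qherm q (Suc (Suc n)) x = 2 * x * qherm q (Suc n) x - (1 - q ^ Suc n) * qherm q n x"

definition lfac :: "real \<Rightarrow> real \<Rightarrow> real" where
  "lfac x a = (1 + a)\<^sup>2 - 4 * a * x\<^sup>2"

definition f_h :: "real \<Rightarrow> real \<Rightarrow> real" where
  "f_h q x = 2 * qfac_inf q * sqrt (1 - x\<^sup>2) / pi * (\<Prod>k. lfac x (q ^ Suc k))"

text \<open>The generating function; it is only used for \<open>\<bar>t\<bar> < 1\<close>, \<open>\<bar>q\<bar> < 1\<close>, \<open>\<bar>x\<bar> \<le> 1\<close>,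
  where the series converges.\<close>
definition phi_h :: "real \<Rightarrow> real \<Rightarrow> real \<Rightarrow> real" where
  "phi_h q t x = (\<Sum>j. t ^ j / qfac q j * qherm q j x)"

text \<open>The parameter vector \<open>(a\<^sub>1, \<dots>, a\<^sub>n)\<close> is a list of length \<open>n\<close>, indexed from \<open>0\<close>.\<close>
definition g_n :: "real \<Rightarrow> real list \<Rightarrow> real \<Rightarrow> real" where
  "g_n q a x = f_h q x * (\<Prod>j<length a. phi_h q (a ! j) x)"

definition symmetric_fun :: "nat \<Rightarrow> (real list \<Rightarrow> real) \<Rightarrow> bool" where
  "symmetric_fun n F \<longleftrightarrow>
     (\<forall>a \<sigma>. length a = n \<longrightarrow> \<sigma> permutes {..<n} \<longrightarrow> F (permute_list \<sigma> a) = F a)"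

end

theory Submission imports Defs begin

text \<open>
  The density \<open>f_h\<close> is a common factor of both sides, so the claim is that a product of
  generating functions \<open>\<Prod> \<phi>\<^sub>h(x|a\<^sub>k,q)\<close> is again a series in the normalised polynomials
  \<open>H\<^sub>n = h\<^sub>n / (q)\<^sub>n\<close>, with square summable coefficients. The constant \<open>A\<^sub>n = 1\<close> will do.

  Each factor is the series \<open>\<Sum> a\<^sup>n H\<^sub>n\<close>, whose coefficients decay geometrically. Series with
  geometrically decaying coefficients are closed under multiplication. The reason is the
  linearisation formula of Rogers,
  \<open>H\<^sub>m H\<^sub>n = \<Sum>\<^sub>k (q)\<^bsub>m+n-2k\<^esub> / ((q)\<^sub>k (q)\<^bsub>m-k\<^esub> (q)\<^bsub>n-k\<^esub>) H\<^bsub>m+n-2k\<^esub>\<close>.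
  Since \<open>(q)\<^sub>n\<close> stays between two positive constants, its coefficients are bounded
  uniformly in \<open>m\<close>, \<open>n\<close> and \<open>k\<close>, and every index on the right is at most \<open>m + n\<close>. A coefficient
  of size \<open>r\<^bsup>m+n\<^esup>\<close> therefore never ends up at an index larger than its exponent, and the product
  again has geometrically decaying coefficients, up to a linear factor that a slightly larger
  rate absorbs. The rearrangement is legitimate because \<open>H\<^sub>n\<close> grows at most linearly in \<open>n\<close>
  on \<open>[-1, 1]\<close>. This bound comes from the expansion of \<open>H\<^sub>n(cos \<theta>)\<close> in powers of \<open>e\<^bsup>i\<theta>\<^esup>\<close>.

  Induction on the multiset of parameters then gives the expansion of the full product. The
  coefficients are chosen as a function of that multiset, so they are symmetric in the
  parameters.
\<close>

section \<open>Bounds for the q-factorials\<close>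

lemma qfac_0 [simp]: "qfac q 0 = 1"
  by (simp add: qfac_def)

lemma qfac_Suc: "qfac q (Suc n) = (1 - q ^ Suc n) * qfac q n"
  by (simp add: qfac_def)

lemma one_minus_power_pos:
  fixes q :: real
  assumes "\<bar>q\<bar> < 1"
  shows "1 - q ^ Suc n > 0"
proof -
  have "\<bar>q\<bar> ^ Suc n < 1"
    unfolding power_less_one_iff[OF abs_ge_zero] using assms by simp
  moreover have "q ^ Suc n \<le> \<bar>q\<bar> ^ Suc n"
    by (metis abs_ge_self power_abs)
  ultimately show ?thesis by linarith
qed

lemma qfac_pos: "\<bar>q\<bar> < 1 \<Longrightarrow> qfac q n > 0"
  by (induction n) (simp_all only: qfac_0 qfac_Suc zero_less_one mult_pos_pos one_minus_power_pos)

text \<open>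
  The infinite product \<open>(q)\<^sub>\<infinity>\<close> converges absolutely and has no vanishing factor, so both
  \<open>(q)\<^sub>n\<close> and its reciprocal are convergent sequences, hence bounded.
\<close>

lemma qfac_bounds:
  assumes "\<bar>q\<bar> < 1"
  obtains c C where "0 < c" "0 < C" "\<And>n. c \<le> qfac q n" "\<And>n. qfac q n \<le> C"
proof -
  let ?f = "\<lambda>k. 1 - q ^ Suc k"
  have "summable (\<lambda>k. \<bar>q\<bar> ^ Suc k)"
    using assms by (simp add: summable_geometric)
  then have "summable (\<lambda>k. norm (?f k - 1))"
    by (simp add: power_abs abs_mult)
  then have conv: "convergent_prod ?f"
    by (intro abs_convergent_prod_imp_convergent_prod summable_imp_abs_convergent_prod)
  have "?f k \<noteq> 0" for k
    using one_minus_power_pos[OF assms, of k] by linarith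
  then have nz: "prodinf ?f \<noteq> 0"
    using prodinf_nonzero[OF conv] by blast
  have "qfac q (Suc n) = (\<Prod>k\<le>n. ?f k)" for n
    by (induction n) (simp_all add: qfac_Suc)
  then have lim: "(\<lambda>n. qfac q (Suc n)) \<longlonglongrightarrow> prodinf ?f"
    using convergent_prod_LIMSEQ[OF conv] by simp
  then have lim: "qfac q \<longlonglongrightarrow> prodinf ?f"
    by (rule LIMSEQ_imp_Suc)
  obtain C where C: "C > 0" "\<And>n. norm (qfac q n) \<le> C"
    using convergent_imp_Bseq[OF convergentI[OF lim]] by (meson Bseq_def)
  obtain D where D: "D > 0" "\<And>n. norm (inverse (qfac q n)) \<le> D"
    using convergent_imp_Bseq[OF convergentI[OF tendsto_inverse[OF lim nz]]] by (meson Bseq_def)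
  show thesis
  proof (rule that[of "inverse D" C])
    show "inverse D \<le> qfac q n" for n
      using D(2)[of n] D(1) qfac_pos[OF assms, of n] by (simp add: field_simps)
    show "qfac q n \<le> C" for n
      using C(2)[of n] by simp
  qed (use C D in auto)
qed

section \<open>Linear growth of the normalised polynomials\<close>

definition nherm :: "real \<Rightarrow> nat \<Rightarrow> real \<Rightarrow> real" where
  "nherm q n x = qherm q n x / qfac q n"

lemma nherm_0 [simp]: "nherm q 0 x = 1"
  by (simp add: nherm_def)

lemma nherm_Suc_Suc:
  assumes "\<bar>q\<bar> < 1"
  shows "(1 - q ^ Suc (Suc n)) * nherm q (Suc (Suc n)) x = 2 * x * nherm q (Suc n) x - nherm q n x"
proof -
  note pos = qfac_pos[OF assms, of n] one_minus_power_pos[OF assms, of n]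
    one_minus_power_pos[OF assms, of "Suc n"]
  have cancel: "a * (H / (a * (b * p))) = 2 * x * (h / (b * p)) - g / p"
    if "H = 2 * x * h - b * g" "a > 0" "b > 0" "p > 0" for a b p H h g :: real
    using that by (simp add: field_simps)
  show ?thesis
    unfolding nherm_def qfac_Suc
    by (rule cancel) (use pos in \<open>simp_all del: power_Suc\<close>)
qed

text \<open>
  For \<open>z = e\<^bsup>i\<theta>\<^esup>\<close> and \<open>w = 1 / z\<close> this is the Cauchy product behind the factorisation of
  the generating function into \<open>\<Sum> (z t)\<^sup>k / (q)\<^sub>k\<close> and \<open>\<Sum> (w t)\<^sup>k / (q)\<^sub>k\<close>. The right-hand side satisfies
  the recurrence of \<open>H\<^sub>n\<close>: write \<open>1 - q\<^sup>n\<close> as \<open>(1 - q\<^sup>k) + q\<^sup>k (1 - q\<^bsup>n-k\<^esup>)\<close>, and each of the two parts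
  cancels the last factor of one of the two \<open>q\<close>-factorials.
\<close>

lemma nherm_explicit:
  fixes z w :: complex
  assumes q: "\<bar>q\<bar> < 1" and zw: "z * w = 1" "z + w = of_real (2 * x)"
  shows "of_real (nherm q n x) =
    (\<Sum>k\<le>n. z ^ k / of_real (qfac q k) * (w ^ (n - k) / of_real (qfac q (n - k))))"
proof -
  define u where "u = (\<lambda>k. z ^ k / complex_of_real (qfac q k))"
  define v where "v = (\<lambda>k. w ^ k / complex_of_real (qfac q k))"
  have red: "(1 - of_real q ^ Suc k) * (y ^ Suc k / complex_of_real (qfac q (Suc k)))
      = y * (y ^ k / complex_of_real (qfac q k))" for y k
  proof -
    have "complex_of_real (1 - q ^ Suc k) \<noteq> 0" "complex_of_real (qfac q k) \<noteq> 0"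
      using one_minus_power_pos[OF q, of k] qfac_pos[OF q, of k]
      unfolding of_real_eq_0_iff by linarith+
    then show ?thesis
      by (simp add: qfac_Suc field_simps)
  qed
  have u: "(1 - of_real q ^ Suc k) * u (Suc k) = z * u k" for k
    using red[of k z] by (simp add: u_def)
  have v: "(1 - of_real q ^ Suc k) * v (Suc k) = w * v k" for k
    using red[of k w] by (simp add: v_def)
  define s where "s = (\<lambda>n. \<Sum>k\<le>n. u k * v (n - k))"
  have shift: "(\<Sum>k\<le>Suc n. (1 - of_real q ^ k) * u k * v (Suc n - k)) = z * s n" for n
  proof -
    have "(\<Sum>k\<le>Suc n. (1 - of_real q ^ k) * u k * v (Suc n - k))
        = (\<Sum>k\<le>n. (1 - of_real q ^ Suc k) * u (Suc k) * v (n - k))"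
      by (subst sum.atMost_Suc_shift) simp
    also have "\<dots> = z * s n"
      unfolding u s_def sum_distrib_left by (simp add: mult.assoc)
    finally show ?thesis .
  qed
  have rec: "(1 - of_real q ^ Suc (Suc n)) * s (Suc (Suc n)) = (z + w) * s (Suc n) - s n" for n
  proof -
    let ?Q = "complex_of_real q"
    let ?N = "Suc (Suc n)"
    have "(1 - ?Q ^ ?N) * s ?N =
        (\<Sum>k\<le>?N. (1 - ?Q ^ k) * u k * v (?N - k) + ?Q ^ k * u k * ((1 - ?Q ^ (?N - k)) * v (?N - k)))"
      unfolding s_def sum_distrib_left
    proof (rule sum.cong)
      fix k assume "k \<in> {..?N}"
      then have e: "?Q ^ ?N = ?Q ^ k * ?Q ^ (?N - k)"
        by (simp flip: power_add del: power_Suc)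
      show "(1 - ?Q ^ ?N) * (u k * v (?N - k)) =
        (1 - ?Q ^ k) * u k * v (?N - k) + ?Q ^ k * u k * ((1 - ?Q ^ (?N - k)) * v (?N - k))"
        unfolding e by (simp add: algebra_simps)
    qed simp
    also have "\<dots> = z * s (Suc n)
        + (\<Sum>k\<le>?N. ?Q ^ k * u k * ((1 - ?Q ^ (?N - k)) * v (?N - k)))"
      by (simp only: sum.distrib shift)
    also have "(\<Sum>k\<le>?N. ?Q ^ k * u k * ((1 - ?Q ^ (?N - k)) * v (?N - k)))
        = (\<Sum>k\<le>Suc n. ?Q ^ k * u k * ((1 - ?Q ^ (?N - k)) * v (?N - k)))"
      by (subst sum.atMost_Suc) simp
    also have "\<dots> = (\<Sum>k\<le>Suc n. w * (u k * v (Suc n - k)) - w * ((1 - ?Q ^ k) * u k * v (Suc n - k)))"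
    proof (rule sum.cong)
      fix k assume "k \<in> {..Suc n}"
      then have e: "?N - k = Suc (Suc n - k)" by auto
      show "?Q ^ k * u k * ((1 - ?Q ^ (?N - k)) * v (?N - k)) =
        w * (u k * v (Suc n - k)) - w * ((1 - ?Q ^ k) * u k * v (Suc n - k))"
        unfolding e v by (simp add: algebra_simps)
    qed simp
    also have "\<dots> = w * s (Suc n) - w * (z * s n)"
      unfolding sum_subtractf sum_distrib_left [symmetric] shift by (simp add: s_def)
    also have "w * (z * s n) = s n"
      using zw(1) by (simp add: mult.commute mult.left_commute)
    finally show ?thesis
      by (simp add: algebra_simps)
  qed
  have "of_real (nherm q n x) = s n \<and> of_real (nherm q (Suc n) x) = s (Suc n)"
  proof (induction n)
    case 0
    have "1 - q > 0" using q by auto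
    then have "complex_of_real (1 - q) \<noteq> 0" unfolding of_real_eq_0_iff by linarith
    then show ?case
      using zw(2) by (simp add: s_def u_def v_def nherm_def qfac_Suc add_divide_distrib [symmetric] add.commute)
  next
    case (Suc n)
    have nz: "complex_of_real (1 - q ^ Suc (Suc n)) \<noteq> 0"
      using one_minus_power_pos[OF q, of "Suc n"] unfolding of_real_eq_0_iff by linarith
    have "complex_of_real (1 - q ^ Suc (Suc n)) * of_real (nherm q (Suc (Suc n)) x)
        = of_real (2 * x * nherm q (Suc n) x - nherm q n x)"
      unfolding of_real_mult [symmetric] nherm_Suc_Suc[OF q] ..
    also have "\<dots> = complex_of_real (1 - q ^ Suc (Suc n)) * s (Suc (Suc n))"
      using Suc rec[of n] zw(2) by simp
    finally show ?case
      using nz Suc by (simp del: power_Suc)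
  qed
  then show ?thesis
    by (simp add: s_def u_def v_def)
qed

lemma nherm_bound:
  assumes q: "\<bar>q\<bar> < 1"
  obtains K where "K > 0" "\<And>n x. \<bar>x\<bar> \<le> 1 \<Longrightarrow> \<bar>nherm q n x\<bar> \<le> K * (real n + 1)"
proof -
  obtain c C where c: "0 < c" "\<And>n. c \<le> qfac q n"
    using qfac_bounds[OF q] by metis
  show thesis
  proof (rule that[of "1 / (c * c)"])
    fix n and x :: real
    assume x: "\<bar>x\<bar> \<le> 1"
    \<comment> \<open>With \<open>x = cos \<theta>\<close>, this is \<open>e\<^bsup>i\<theta>\<^esup>\<close>.\<close>
    define z where "z = Complex x (sqrt (1 - x\<^sup>2))"
    have "1 - x\<^sup>2 \<ge> 0"
      using x by (simp add: abs_square_le_1)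
    then have nz: "norm z = 1"
      by (simp add: z_def complex_norm)
    have zz: "z * cnj z = 1"
      using nz complex_norm_square[of z] by simp
    have sz: "z + cnj z = of_real (2 * x)"
      by (simp add: complex_add_cnj z_def)
    have "\<bar>nherm q n x\<bar> = norm (complex_of_real (nherm q n x))"
      by simp
    also have "\<dots> \<le> (\<Sum>k\<le>n. 1 / (c * c))"
      unfolding nherm_explicit[OF q zz sz]
    proof (rule sum_norm_le)
      fix k
      have "1 / \<bar>qfac q k\<bar> \<le> 1 / c" for k
        using c(1) c(2)[of k] by (intro divide_left_mono) auto
      from mult_mono[OF this[of k] this[of "n - k"]]
      show "norm (z ^ k / of_real (qfac q k) * (cnj z ^ (n - k) / of_real (qfac q (n - k)))) \<le> 1 / (c * c)"
        using nz c(1) by (simp add: norm_mult norm_divide norm_power)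
    qed
    also have "\<dots> = 1 / (c * c) * (real n + 1)"
      by (simp add: algebra_simps)
    finally show "\<bar>nherm q n x\<bar> \<le> 1 / (c * c) * (real n + 1)" .
  qed (use c in auto)
qed

section \<open>Linearisation of products\<close>

text \<open>
  Extension of \<open>1 / (q)\<^sub>n\<close> to the integers. The value \<open>0\<close> at negative indices keeps the
  recurrence of the reciprocal \<open>q\<close>-factorials valid everywhere, so the induction for the
  linearisation formula needs no special treatment of the ends of the sum.
\<close>

definition rfac :: "real \<Rightarrow> int \<Rightarrow> real" where
  "rfac q i = (if i < 0 then 0 else 1 / qfac q (nat i))"

text \<open>Extension of \<open>h\<^sub>n\<close> by \<open>h\<^sub>n = 0\<close> for \<open>n < 0\<close>, which continues the convention \<open>h\<^bsub>-1\<^esub> = 0\<close>.\<close>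

definition zherm :: "real \<Rightarrow> int \<Rightarrow> real \<Rightarrow> real" where
  "zherm q i x = (if i < 0 then 0 else qherm q (nat i) x)"

lemma rfac_pred:
  assumes "\<bar>q\<bar> < 1"
  shows "rfac q (i - 1) = (1 - q ^ nat i) * rfac q i"
proof (cases "i > 0")
  case True
  then have e: "nat i = Suc (nat (i - 1))" by simp
  have "1 - q ^ Suc (nat (i - 1)) > 0"
    using one_minus_power_pos[OF assms] .
  with True show ?thesis
    unfolding rfac_def e qfac_Suc by (simp del: power_Suc)
qed (auto simp: rfac_def)

lemma zherm_rec:
  assumes "i \<ge> 0"
  shows "2 * x * zherm q i x = zherm q (i + 1) x + (1 - q ^ nat i) * zherm q (i - 1) x"
proof (cases "i = 0")
  case False
  with assms obtain n where "i = int (Suc n)"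
    by (metis nonneg_int_cases not0_implies_Suc of_nat_0)
  then show ?thesis
    by (simp add: zherm_def nat_add_distrib algebra_simps)
qed (simp add: zherm_def)

text \<open>
  The recurrence of the linearisation coefficients. In terms of \<open>A = q\<^sup>a\<close>, \<open>B = q\<^sup>b\<close> and
  \<open>C = q\<^sup>c\<close>, dividing by \<open>1 / ((q)\<^sub>a (q)\<^sub>b (q)\<^sub>c)\<close> leaves the polynomial identity
  \<open>(1 - A) (1 - B) + (1 - C) (1 - A B) - (1 - C) (1 - A) = (1 - A C) (1 - B)\<close>.
\<close>

lemma linearisation_coeff_rec:
  fixes a b c :: int
  assumes q: "\<bar>q\<bar> < 1"
  shows "rfac q c * rfac q (a - 1) * rfac q (b - 1)
      + rfac q (c - 1) * rfac q a * rfac q b * (1 - q ^ nat (a + b))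
      - rfac q (c - 1) * rfac q (a - 1) * rfac q b
    = (1 - q ^ nat (a + c)) * (rfac q c * rfac q a * rfac q (b - 1))"
proof (cases "a < 0 \<or> b < 0 \<or> c < 0")
  case True
  then show ?thesis by (auto simp: rfac_def)
next
  case False
  then show ?thesis
    by (simp add: rfac_pred[OF q] nat_add_distrib power_add) (simp add: algebra_simps)
qed

text \<open>
  Induction on \<open>m\<close>: multiply the formula for \<open>H\<^sub>m H\<^sub>n\<close> by \<open>2 x\<close>, expand every \<open>2 x h\<^sub>i\<close> by the
  three-term recurrence, subtract the formula for \<open>H\<^bsub>m-1\<^esub> H\<^sub>n\<close>, and compare coefficients. The
  start at \<open>m = -1\<close>, where everything vanishes, provides both hypotheses that the first step
  needs. The free upper limit \<open>K\<close> lets the sums for \<open>m - 1\<close>, \<open>m\<close> and \<open>m + 1\<close> be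
  compared term by term.
\<close>

lemma linearisation_int:
  assumes q: "\<bar>q\<bar> < 1" and m: "m \<ge> -1" "m \<le> int K" and n: "n \<ge> 0"
  shows "rfac q m * zherm q m x * (rfac q n * zherm q n x) =
    (\<Sum>k\<le>K. rfac q (int k) * rfac q (m - int k) * rfac q (n - int k) * zherm q (m + n - 2 * int k) x)"
proof -
  let ?c = "\<lambda>m k. rfac q (int k) * rfac q (m - int k) * rfac q (n - int k)"
  let ?s = "\<lambda>m K. \<Sum>k\<le>K. ?c m k * zherm q (m + n - 2 * int k) x"
  let ?P = "\<lambda>m. \<forall>K. m \<le> int K \<longrightarrow> rfac q m * zherm q m x * (rfac q n * zherm q n x) = ?s m K"
  have "?P (int m - 1) \<and> ?P (int m)" for m
  proof (induction m)
    case 0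
    have "?s 0 K = ?c 0 0 * zherm q n x" for K
    proof -
      have "?s 0 K = (\<Sum>k\<in>{0}. ?c 0 k * zherm q (0 + n - 2 * int k) x)"
        by (rule sum.mono_neutral_right) (auto simp: rfac_def)
      then show ?thesis by simp
    qed
    then show ?case
      by (simp add: rfac_def zherm_def)
  next
    case (Suc m)
    let ?m = "int m"
    have "?P (?m + 1)"
    proof (intro allI impI)
      fix K assume "?m + 1 \<le> int K"
      then obtain L where K: "K = Suc L" and L: "m \<le> L"
        by (cases K) auto
      let ?z = "\<lambda>i. zherm q i x"
      let ?N = "rfac q n * ?z n"
      \<comment> \<open>The three-term recurrence fails at index \<open>-1\<close>, but the coefficient vanishes wherever
        the index is negative.\<close>
      have expand: "2 * x * (?c ?m k * ?z (?m + n - 2 * int k)) =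
          ?c ?m k * ?z (?m + n + 1 - 2 * int k) +
          ?c ?m k * (1 - q ^ nat (?m + n - 2 * int k)) * ?z (?m + n - 1 - 2 * int k)" for k
      proof (cases "?m - int k < 0 \<or> n - int k < 0")
        case True
        then have "?c ?m k = 0" by (auto simp: rfac_def)
        then show ?thesis by (simp only: mult_zero_left mult_zero_right add_0)
      next
        case False
        then have "?m + n - 2 * int k \<ge> 0" by linarith
        moreover have "?m + n - 2 * int k - 1 = ?m + n - 1 - 2 * int k"
          "?m + n - 2 * int k + 1 = ?m + n + 1 - 2 * int k"
          by simp_all
        ultimately have eq: "2 * x * ?z (?m + n - 2 * int k) = ?z (?m + n + 1 - 2 * int k)
            + (1 - q ^ nat (?m + n - 2 * int k)) * ?z (?m + n - 1 - 2 * int k)"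
          using zherm_rec[of "?m + n - 2 * int k" x q] by (simp only:)
        show ?thesis
          unfolding mult.left_commute[of "2 * x" "?c ?m k"] eq
          by (simp only: distrib_left mult.assoc)
      qed
      let ?Q = "1 - q ^ Suc m"
      have pred: "rfac q ?m = ?Q * rfac q (?m + 1)"
      proof -
        have "nat (?m + 1) = Suc m" "?m + 1 - 1 = ?m" by simp_all
        then show ?thesis
          using rfac_pred[OF q, of "?m + 1"] by (simp only:)
      qed
      have "?Q * (rfac q (?m + 1) * ?z (?m + 1)) = rfac q ?m * ?z (?m + 1)"
        by (simp only: pred mult.assoc)
      also have "\<dots> = 2 * x * (rfac q ?m * ?z ?m) - rfac q (?m - 1) * ?z (?m - 1)"
      proof -
        have z: "?z (?m + 1) = 2 * x * ?z ?m - (1 - q ^ m) * ?z (?m - 1)"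
          and r: "rfac q (?m - 1) = (1 - q ^ m) * rfac q ?m"
          using zherm_rec[of ?m x q] rfac_pred[OF q, of ?m] by simp_all
        show ?thesis
          unfolding z r by (simp add: algebra_simps)
      qed
      finally have lhs: "?Q * (rfac q (?m + 1) * ?z (?m + 1) * ?N) =
          2 * x * (rfac q ?m * ?z ?m * ?N) - rfac q (?m - 1) * ?z (?m - 1) * ?N"
        by (simp only: mult.assoc [symmetric] left_diff_distrib)
      have IH: "rfac q ?m * ?z ?m * ?N = ?s ?m L"
          "rfac q (?m - 1) * ?z (?m - 1) * ?N = ?s (?m - 1) L"
        using Suc L by auto
      \<comment> \<open>Shifting \<open>k\<close> by one lines up the terms with raised index with those whose index
        was lowered.\<close>
      have up: "(\<Sum>k\<le>L. ?c ?m k * ?z (?m + n + 1 - 2 * int k)) =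
          ?c ?m 0 * ?z (?m + n + 1) + (\<Sum>k\<le>L. ?c ?m (Suc k) * ?z (?m + n - 1 - 2 * int k))"
      proof -
        have "(\<Sum>k\<le>L. ?c ?m k * ?z (?m + n + 1 - 2 * int k))
            = (\<Sum>k\<le>Suc L. ?c ?m k * ?z (?m + n + 1 - 2 * int k))"
          using L by (subst sum.atMost_Suc) (simp add: rfac_def)
        also have "\<dots> = ?c ?m 0 * ?z (?m + n + 1 - 2 * int 0)
            + (\<Sum>k\<le>L. ?c ?m (Suc k) * ?z (?m + n + 1 - 2 * int (Suc k)))"
          by (rule sum.atMost_Suc_shift)
        finally have "(\<Sum>k\<le>L. ?c ?m k * ?z (?m + n + 1 - 2 * int k))
            = ?c ?m 0 * ?z (?m + n + 1 - 2 * int 0)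
            + (\<Sum>k\<le>L. ?c ?m (Suc k) * ?z (?m + n + 1 - 2 * int (Suc k)))" .
        moreover have "?m + n + 1 - 2 * int (Suc k) = ?m + n - 1 - 2 * int k"
          "?m + n + 1 - 2 * int 0 = ?m + n + 1" for k
          by simp_all
        ultimately show ?thesis by (simp only:)
      qed
      have coeff: "?c ?m (Suc k) + ?c ?m k * (1 - q ^ nat (?m + n - 2 * int k)) - ?c (?m - 1) k
          = ?Q * ?c (?m + 1) (Suc k)" for k
      proof -
        have "?m - int k - 1 = ?m - int (Suc k)" "n - int k - 1 = n - int (Suc k)"
          "int (Suc k) - 1 = int k" "?m - int k + (n - int k) = ?m + n - 2 * int k"
          "nat (?m - int k + int (Suc k)) = Suc m" "?m + 1 - int (Suc k) = ?m - int k"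
          "?m - 1 - int k = ?m - int (Suc k)"
          by simp_all
        then show ?thesis
          using linearisation_coeff_rec[OF q, of "int (Suc k)" "?m - int k" "n - int k"]
          by (simp only:)
      qed
      have "?Q * (rfac q (?m + 1) * ?z (?m + 1) * ?N) = 2 * x * ?s ?m L - ?s (?m - 1) L"
        unfolding lhs IH ..
      also have "2 * x * ?s ?m L = ?c ?m 0 * ?z (?m + n + 1)
          + (\<Sum>k\<le>L. ?c ?m (Suc k) * ?z (?m + n - 1 - 2 * int k))
          + (\<Sum>k\<le>L. ?c ?m k * (1 - q ^ nat (?m + n - 2 * int k)) * ?z (?m + n - 1 - 2 * int k))"
        unfolding sum_distrib_left expand sum.distrib up ..
      also have "?s (?m - 1) L = (\<Sum>k\<le>L. ?c (?m - 1) k * ?z (?m + n - 1 - 2 * int k))"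
        by (simp add: algebra_simps)
      also have "?c ?m 0 * ?z (?m + n + 1)
          + (\<Sum>k\<le>L. ?c ?m (Suc k) * ?z (?m + n - 1 - 2 * int k))
          + (\<Sum>k\<le>L. ?c ?m k * (1 - q ^ nat (?m + n - 2 * int k)) * ?z (?m + n - 1 - 2 * int k))
          - (\<Sum>k\<le>L. ?c (?m - 1) k * ?z (?m + n - 1 - 2 * int k)) =
        ?c ?m 0 * ?z (?m + n + 1) + (\<Sum>k\<le>L. ?Q * ?c (?m + 1) (Suc k) * ?z (?m + n - 1 - 2 * int k))"
        by (simp only: coeff [symmetric])
          (simp only: left_diff_distrib distrib_right sum.distrib sum_subtractf add_diff_eq add.assoc)
      also have "\<dots> = ?Q * (?c (?m + 1) 0 * ?z (?m + n + 1)
          + (\<Sum>k\<le>L. ?c (?m + 1) (Suc k) * ?z (?m + n - 1 - 2 * int k)))"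
        unfolding distrib_left sum_distrib_left using pred by (simp add: mult.assoc)
      also have "?c (?m + 1) 0 * ?z (?m + n + 1)
          + (\<Sum>k\<le>L. ?c (?m + 1) (Suc k) * ?z (?m + n - 1 - 2 * int k)) = ?s (?m + 1) K"
      proof -
        have "?s (?m + 1) K = ?c (?m + 1) 0 * ?z (?m + 1 + n - 2 * int 0)
            + (\<Sum>k\<le>L. ?c (?m + 1) (Suc k) * ?z (?m + 1 + n - 2 * int (Suc k)))"
          unfolding K by (rule sum.atMost_Suc_shift)
        moreover have "?m + 1 + n - 2 * int (Suc k) = ?m + n - 1 - 2 * int k"
          "?m + 1 + n - 2 * int 0 = ?m + n + 1" for k
          by simp_all
        ultimately show ?thesis by (simp only:)
      qed
      finally show "rfac q (?m + 1) * ?z (?m + 1) * ?N = ?s (?m + 1) K"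
        using one_minus_power_pos[OF q, of m] by (simp del: power_Suc)
    qed
    with Suc show ?case
      by (simp add: add.commute)
  qed
  from this[of "nat (m + 1)"] m show ?thesis
    by simp
qed

text \<open>
  The linearisation formula of Rogers. The index \<open>m + n - 2 k\<close> is written as
  \<open>(m - k) + (n - k)\<close>, the shape it takes when the triple sum is reindexed.
\<close>

lemma linearisation:
  assumes q: "\<bar>q\<bar> < 1"
  shows "nherm q m x * nherm q n x = (\<Sum>k\<le>min m n.
    qfac q (m - k + (n - k)) / (qfac q k * qfac q (m - k) * qfac q (n - k))
      * nherm q (m - k + (n - k)) x)"
proof -
  let ?f = "\<lambda>k. rfac q (int k) * rfac q (int m - int k) * rfac q (int n - int k) *
    zherm q (int m + int n - 2 * int k) x"
  have "nherm q m x * nherm q n x = (\<Sum>k\<le>m. ?f k)"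
    using linearisation_int[OF q, of "int m" m "int n" x]
    by (simp add: nherm_def rfac_def zherm_def)
  also have "\<dots> = (\<Sum>k\<le>min m n. ?f k)"
    by (rule sum.mono_neutral_right) (auto simp: rfac_def)
  also have "\<dots> = (\<Sum>k\<le>min m n.
    qfac q (m - k + (n - k)) / (qfac q k * qfac q (m - k) * qfac q (n - k))
      * nherm q (m - k + (n - k)) x)"
  proof (rule sum.cong)
    fix k assume "k \<in> {..min m n}"
    then have k: "k \<le> m" "k \<le> n" by auto
    then have "nat (int m - int k) = m - k" "nat (int n - int k) = n - k"
      "nat (int m + int n - 2 * int k) = m - k + (n - k)"
      by linarith+
    then show "?f k = qfac q (m - k + (n - k)) / (qfac q k * qfac q (m - k) * qfac q (n - k))
      * nherm q (m - k + (n - k)) x"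
      using k qfac_pos[OF q, of "m - k + (n - k)"]
      by (simp add: rfac_def zherm_def nherm_def)
  qed simp
  finally show ?thesis .
qed

section \<open>Series with geometrically decaying coefficients\<close>

definition geom_decay :: "(nat \<Rightarrow> real) \<Rightarrow> bool" where
  "geom_decay c \<longleftrightarrow> (\<exists>M r. 0 < M \<and> 0 < r \<and> r < 1 \<and> (\<forall>n. \<bar>c n\<bar> \<le> M * r ^ n))"

text \<open>
  A linear factor can be absorbed into a slightly larger rate: for \<open>s = \<surd>r\<close>, one factor \<open>s\<^sup>n\<close> of
  \<open>r\<^sup>n = s\<^sup>n s\<^sup>n\<close> tames the linear growth and the other one remains.
\<close>

lemma linear_times_power_bound:
  fixes r :: real
  assumes "0 < r" "r < 1"
  obtains K s where "0 < K" "0 < s" "s < 1" "\<And>n. (real n + 1) * r ^ n \<le> K * s ^ n"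
proof -
  define s where "s = sqrt r"
  have s: "0 < s" "s < 1" "s * s = r"
    using assms by (auto simp: s_def)
  have "(\<lambda>n. real n * s ^ n) \<longlonglongrightarrow> 0"
    using s by (intro powser_times_n_limit_0) auto
  then have "Bseq (\<lambda>n. real n * s ^ n)"
    using convergentI convergent_imp_Bseq by blast
  then obtain K where K: "0 < K" "\<And>n. norm (real n * s ^ n) \<le> K"
    by (meson Bseq_def)
  show thesis
  proof (rule that[of "K + 1" s])
    fix n
    have "(real n + 1) * s ^ n \<le> K + 1"
      using K(2)[of n] s power_le_one[of s n] by (simp add: algebra_simps)
    then have "(real n + 1) * s ^ n * s ^ n \<le> (K + 1) * s ^ n"
      using s by (intro mult_right_mono) auto
    then show "(real n + 1) * r ^ n \<le> (K + 1) * s ^ n"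
      by (simp add: power_mult_distrib algebra_simps flip: s(3))
  qed (use K s in auto)
qed

lemma geom_decay_square_summable:
  assumes "geom_decay c"
  shows "summable (\<lambda>n. (c n)\<^sup>2)"
proof -
  obtain M r where M: "0 < M" "0 < r" "r < 1" "\<And>n. \<bar>c n\<bar> \<le> M * r ^ n"
    using assms unfolding geom_decay_def by metis
  have "summable (\<lambda>n. M\<^sup>2 * (r\<^sup>2) ^ n)"
    using M by (intro summable_mult summable_geometric) (auto simp: abs_square_less_1)
  moreover have "norm ((c n)\<^sup>2) \<le> M\<^sup>2 * (r\<^sup>2) ^ n" for n
    using power_mono[OF M(4)[of n], of 2]
    by (simp add: power_mult_distrib power_mult [symmetric] mult.commute)
  ultimately show ?thesis
    by (rule summable_comparison_test')
qed

lemma geom_decay_series_summable: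
  assumes q: "\<bar>q\<bar> < 1" and x: "\<bar>x\<bar> \<le> 1" and c: "geom_decay c"
  shows "summable (\<lambda>n. norm (c n * nherm q n x))"
proof -
  obtain M r where M: "0 < M" "0 < r" "r < 1" "\<And>n. \<bar>c n\<bar> \<le> M * r ^ n"
    using c unfolding geom_decay_def by metis
  obtain L where L: "L > 0" "\<And>n x. \<bar>x\<bar> \<le> 1 \<Longrightarrow> \<bar>nherm q n x\<bar> \<le> L * (real n + 1)"
    using nherm_bound[OF q] by metis
  obtain K s where K: "0 < K" "0 < s" "s < 1" "\<And>n. (real n + 1) * r ^ n \<le> K * s ^ n"
    using linear_times_power_bound[OF M(2,3)] by metis
  have "summable (\<lambda>n. M * L * K * s ^ n)"
    using K by (intro summable_mult summable_geometric) auto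
  moreover have "norm (norm (c n * nherm q n x)) \<le> M * L * K * s ^ n" for n
  proof -
    have "\<bar>c n\<bar> * \<bar>nherm q n x\<bar> \<le> (M * r ^ n) * (L * (real n + 1))"
      using M L x by (intro mult_mono) auto
    also have "\<dots> = M * L * ((real n + 1) * r ^ n)"
      by (simp add: algebra_simps)
    also have "\<dots> \<le> M * L * (K * s ^ n)"
      using K M L by (intro mult_left_mono) auto
    finally show ?thesis
      by (simp add: abs_mult algebra_simps)
  qed
  ultimately show ?thesis
    by (rule summable_comparison_test')
qed

lemma geom_decay_common_rate:
  assumes "geom_decay S" "geom_decay R"
  obtains M r where "0 < M" "0 < r" "r < 1" "\<And>n. \<bar>S n\<bar> \<le> M * r ^ n" "\<And>n. \<bar>R n\<bar> \<le> M * r ^ n"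
proof -
  obtain M r where M: "0 < M" "0 < r" "r < 1" "\<And>n. \<bar>S n\<bar> \<le> M * r ^ n"
    using assms(1) unfolding geom_decay_def by metis
  obtain N s where N: "0 < N" "0 < s" "s < 1" "\<And>n. \<bar>R n\<bar> \<le> N * s ^ n"
    using assms(2) unfolding geom_decay_def by metis
  show thesis
  proof (rule that[of "max M N" "max r s"])
    show "\<bar>S n\<bar> \<le> max M N * max r s ^ n" for n
      by (rule order_trans[OF M(4)], intro mult_mono power_mono) (use M in auto)
    show "\<bar>R n\<bar> \<le> max M N * max r s ^ n" for n
      by (rule order_trans[OF N(4)], intro mult_mono power_mono) (use N in auto)
  qed (use M N in auto)
qed

section \<open>Products of series\<close>

lemma nonneg_summable_on_Times:
  fixes f :: "'a \<Rightarrow> real" and g :: "'b \<Rightarrow> real"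
  assumes "f summable_on A" "g summable_on B" "\<And>x. 0 \<le> f x" "\<And>y. 0 \<le> g y"
  shows "(\<lambda>(x, y). f x * g y) summable_on A \<times> B"
proof (rule summable_on_SigmaI)
  show "((\<lambda>y. case (x, y) of (x, y) \<Rightarrow> f x * g y) has_sum f x * infsum g B) B" for x
    using assms(2) by (auto intro!: has_sum_cmult_right)
  show "(\<lambda>x. f x * infsum g B) summable_on A"
    using assms(1) by (rule summable_on_cmult_left)
qed (use assms in auto)

text \<open>
  The contribution of \<open>S\<^sub>m R\<^sub>n\<close> to the coefficient of \<open>H\<^bsub>i+j\<^esub>\<close> in the product of \<open>\<Sum> S\<^sub>m H\<^sub>m\<close>
  and \<open>\<Sum> R\<^sub>n H\<^sub>n\<close>, where \<open>m = i + k\<close> and \<open>n = j + k\<close>. In these variables the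
  triples range over all of \<open>\<nat>\<^sup>3\<close>, without the constraint \<open>k \<le> min m n\<close>.
\<close>

definition prod_term :: "real \<Rightarrow> (nat \<Rightarrow> real) \<Rightarrow> (nat \<Rightarrow> real) \<Rightarrow> nat \<Rightarrow> nat \<Rightarrow> nat \<Rightarrow> real" where
  "prod_term q S R i j k =
    S (i + k) * R (j + k) * (qfac q (i + j) / (qfac q k * qfac q i * qfac q j))"

definition prod_coeff :: "real \<Rightarrow> (nat \<Rightarrow> real) \<Rightarrow> (nat \<Rightarrow> real) \<Rightarrow> nat \<Rightarrow> real" where
  "prod_coeff q S R l = (\<Sum>i\<le>l. \<Sum>\<^sub>\<infinity>k. prod_term q S R i (l - i) k)"

lemma prod_term_bound:
  assumes q: "\<bar>q\<bar> < 1" and S: "geom_decay S" and R: "geom_decay R"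
  obtains M r where "0 < M" "0 < r" "r < 1"
    "\<And>i j k. \<bar>prod_term q S R i j k\<bar> \<le> M * r ^ (i + j) * r ^ k"
proof -
  obtain c C where c: "0 < c" "0 < C" "\<And>n. c \<le> qfac q n" "\<And>n. qfac q n \<le> C"
    using qfac_bounds[OF q] by metis
  obtain M r where M: "0 < M" "0 < r" "r < 1"
    "\<And>n. \<bar>S n\<bar> \<le> M * r ^ n" "\<And>n. \<bar>R n\<bar> \<le> M * r ^ n"
    using geom_decay_common_rate[OF S R] by metis
  show thesis
  proof (rule that[of "M * M * (C / (c * c * c))" r])
    fix i j k
    have "0 < qfac q n" for n
      using qfac_pos[OF q] .
    note p = this this[THEN less_imp_le]
    have "\<bar>qfac q (i + j) / (qfac q k * qfac q i * qfac q j)\<bar>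
        = qfac q (i + j) / (qfac q k * qfac q i * qfac q j)"
      using p by simp
    also have "\<dots> \<le> C / (c * c * c)"
      using c p by (intro frac_le mult_mono) (auto intro: less_imp_le)
    finally have w: "\<bar>qfac q (i + j) / (qfac q k * qfac q i * qfac q j)\<bar> \<le> C / (c * c * c)" .
    have "\<bar>prod_term q S R i j k\<bar> \<le> (M * r ^ (i + k)) * (M * r ^ (j + k)) * (C / (c * c * c))"
      unfolding prod_term_def abs_mult by (intro mult_mono M w) (use M in auto)
    also have "\<dots> = M * M * (C / (c * c * c)) * r ^ (i + j) * r ^ k * r ^ k"
      by (simp add: power_add)
    also have "\<dots> \<le> M * M * (C / (c * c * c)) * r ^ (i + j) * r ^ k * 1"
      using M c by (intro mult_left_mono power_le_one) auto
    finally show "\<bar>prod_term q S R i j k\<bar> \<le> M * M * (C / (c * c * c)) * r ^ (i + j) * r ^ k"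
      by simp
  qed (use M c in auto)
qed

lemma power_summable_on:
  fixes r :: real
  assumes "0 < r" "r < 1"
  shows "(\<lambda>k. r ^ k) summable_on UNIV"
  using assms by (intro norm_summable_imp_summable_on) (simp add: summable_geometric)

lemma summable_on_dominated:
  fixes f g :: "'a \<Rightarrow> real"
  assumes "g summable_on A" "\<And>x. x \<in> A \<Longrightarrow> \<bar>f x\<bar> \<le> g x"
  shows "f summable_on A"
  using abs_summable_summable[OF Infinite_Sum.abs_summable_on_comparison_test'[of g A f]] assms
  by simp

lemma prod_term_summable:
  assumes q: "\<bar>q\<bar> < 1" and S: "geom_decay S" and R: "geom_decay R"
  shows "(\<lambda>k. prod_term q S R i j k) summable_on UNIV"
proof -
  obtain M r where M: "0 < M" "0 < r" "r < 1"
    "\<And>i j k. \<bar>prod_term q S R i j k\<bar> \<le> M * r ^ (i + j) * r ^ k"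
    using prod_term_bound[OF q S R] by metis
  show ?thesis
    by (rule summable_on_dominated[OF summable_on_cmult_right[OF power_summable_on[OF M(2,3)]] M(4)])
qed

text \<open>
  The coefficient at \<open>l\<close> collects \<open>l + 1\<close> pairs \<open>(i, l - i)\<close>, each contributing a geometric
  series in \<open>k\<close> of size \<open>r\<^sup>l\<close>.
\<close>

lemma prod_coeff_geom_decay:
  assumes q: "\<bar>q\<bar> < 1" and S: "geom_decay S" and R: "geom_decay R"
  shows "geom_decay (prod_coeff q S R)"
proof -
  obtain M r where M: "0 < M" "0 < r" "r < 1"
    "\<And>i j k. \<bar>prod_term q S R i j k\<bar> \<le> M * r ^ (i + j) * r ^ k"
    using prod_term_bound[OF q S R] by metis
  obtain K s where K: "0 < K" "0 < s" "s < 1" "\<And>n. (real n + 1) * r ^ n \<le> K * s ^ n"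
    using linear_times_power_bound[OF M(2,3)] by metis
  define G where "G = (\<Sum>\<^sub>\<infinity>k. r ^ k)"
  have G: "G \<ge> 0"
    unfolding G_def using M by (intro infsum_nonneg) auto
  have "\<bar>prod_coeff q S R l\<bar> \<le> M * (G + 1) * K * s ^ l" for l
  proof -
    have "norm (prod_coeff q S R l) \<le> (\<Sum>i\<le>l. M * r ^ l * G)"
      unfolding prod_coeff_def
    proof (rule sum_norm_le)
      fix i assume "i \<in> {..l}"
      then have b: "norm (prod_term q S R i (l - i) k) \<le> M * r ^ l * r ^ k" for k
        using M(4)[of i "l - i" k] by simp
      have "((\<lambda>k. M * r ^ l * r ^ k) has_sum (M * r ^ l * G)) UNIV"
        unfolding G_def using power_summable_on[OF M(2,3)] by (intro has_sum_cmult_right) auto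
      then show "norm (\<Sum>\<^sub>\<infinity>k. prod_term q S R i (l - i) k) \<le> M * r ^ l * G"
        by (rule norm_infsum_le[OF has_sum_infsum[OF prod_term_summable[OF q S R]]]) (rule b)
    qed
    also have "\<dots> = M * G * ((real l + 1) * r ^ l)"
      by (simp add: algebra_simps)
    \<comment> \<open>\<open>G + 1\<close> in place of \<open>G\<close> makes the constant visibly positive.\<close>
    also have "\<dots> \<le> M * (G + 1) * (K * s ^ l)"
      by (rule mult_mono[OF _ K(4)]) (use M G in auto)
    finally show ?thesis
      by (simp add: mult.assoc)
  qed
  moreover have "0 < M * (G + 1) * K"
    using M K G by simp
  ultimately show ?thesis
    unfolding geom_decay_def using K by blast
qed

lemma prod_term_series_summable:
  assumes q: "\<bar>q\<bar> < 1" and x: "\<bar>x\<bar> \<le> 1" and S: "geom_decay S" and R: "geom_decay R"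
  shows "(\<lambda>(i, j, k). prod_term q S R i j k * nherm q (i + j) x) summable_on UNIV"
proof -
  obtain M r where M: "0 < M" "0 < r" "r < 1"
    "\<And>i j k. \<bar>prod_term q S R i j k\<bar> \<le> M * r ^ (i + j) * r ^ k"
    using prod_term_bound[OF q S R] by metis
  obtain L where L: "L > 0" "\<And>n x. \<bar>x\<bar> \<le> 1 \<Longrightarrow> \<bar>nherm q n x\<bar> \<le> L * (real n + 1)"
    using nherm_bound[OF q] by metis
  obtain K s where K: "0 < K" "0 < s" "s < 1" "\<And>n. (real n + 1) * r ^ n \<le> K * s ^ n"
    using linear_times_power_bound[OF M(2,3)] by metis
  let ?g = "\<lambda>(i, j, k). M * L * K * (s ^ i * (s ^ j * r ^ k))"
  have "(\<lambda>(j, k). s ^ j * r ^ k) summable_on UNIV \<times> UNIV"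
    using M K by (intro nonneg_summable_on_Times power_summable_on) auto
  then have "(\<lambda>(i, jk). s ^ i * (case jk of (j, k) \<Rightarrow> s ^ j * r ^ k)) summable_on UNIV \<times> (UNIV \<times> UNIV)"
    using M K by (intro nonneg_summable_on_Times power_summable_on) auto
  then have "(\<lambda>p. M * L * K * (case p of (i, j, k) \<Rightarrow> s ^ i * (s ^ j * r ^ k))) summable_on UNIV"
    by (intro summable_on_cmult_right) (simp add: case_prod_unfold)
  then have g: "?g summable_on UNIV"
    by (simp add: case_prod_unfold)
  have "norm (prod_term q S R i j k * nherm q (i + j) x) \<le> M * L * K * (s ^ i * (s ^ j * r ^ k))"
    for i j k
  proof -
    have "norm (prod_term q S R i j k * nherm q (i + j) x)
        \<le> (M * r ^ (i + j) * r ^ k) * (L * (real (i + j) + 1))"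
      unfolding real_norm_def abs_mult by (rule mult_mono[OF M(4) L(2)[OF x]]) (use M in simp_all)
    also have "\<dots> = M * L * r ^ k * ((real (i + j) + 1) * r ^ (i + j))"
      by (simp add: algebra_simps)
    also have "\<dots> \<le> M * L * r ^ k * (K * s ^ (i + j))"
      by (rule mult_left_mono[OF K(4)]) (use M L in simp)
    finally show ?thesis
      by (simp add: power_add algebra_simps)
  qed
  then show ?thesis
    by (intro summable_on_dominated[OF g]) auto
qed

text \<open>
  The triple series converges absolutely, so it may be summed in two orders. Along \<open>i + j = l\<close> it
  gives the series on the right, and along \<open>(i + k, j + k) = (m, n)\<close> the linearisation
  formula turns it into the product on the left.
\<close>

lemma series_product:
  assumes q: "\<bar>q\<bar> < 1" and x: "\<bar>x\<bar> \<le> 1" and S: "geom_decay S" and R: "geom_decay R"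
  shows "(\<Sum>n. S n * nherm q n x) * (\<Sum>n. R n * nherm q n x) = (\<Sum>l. prod_coeff q S R l * nherm q l x)"
proof -
  let ?H = "\<lambda>n. nherm q n x"
  let ?F = "\<lambda>i j k. prod_term q S R i j k * ?H (i + j)"
  obtain Z where Z: "((\<lambda>(i, j, k). ?F i j k) has_sum Z) UNIV"
    using prod_term_series_summable[OF q x S R] by (auto simp: summable_on_def)

  have 1: "((\<lambda>l. prod_coeff q S R l * ?H l) has_sum Z) UNIV"
  proof -
    have sum: "((\<lambda>((l, i), k). ?F i (l - i) k) has_sum Z) ((SIGMA l:UNIV. {..l}) \<times> UNIV)"
      by (rule iffD1[OF has_sum_reindex_bij_witness[where
            i = "\<lambda>((l, i), k). (i, l - i, k)" and j = "\<lambda>(i, j, k). ((i + j, i), k)"] Z]) auto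
    have "((\<lambda>k. ?F i (l - i) k) has_sum (\<Sum>\<^sub>\<infinity>k. prod_term q S R i (l - i) k) * ?H l) UNIV"
      if "i \<le> l" for i l
    proof -
      have "(\<lambda>k. prod_term q S R i (l - i) k) summable_on UNIV"
        by (rule prod_term_summable[OF q S R])
      then have "((\<lambda>k. prod_term q S R i (l - i) k * ?H l) has_sum
          (\<Sum>\<^sub>\<infinity>k. prod_term q S R i (l - i) k) * ?H l) UNIV"
        by (intro has_sum_cmult_left) auto
      then show ?thesis using that by simp
    qed
    then have "((\<lambda>(l, i). (\<Sum>\<^sub>\<infinity>k. prod_term q S R i (l - i) k) * ?H l) has_sum Z) (SIGMA l:UNIV. {..l})"
      by (intro has_sum_SigmaD[OF sum]) auto
    then show ?thesis
      by (rule has_sum_SigmaD) (auto simp: prod_coeff_def sum_distrib_right intro!: has_sum_finiteI)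
  qed

  have 2: "((\<lambda>m. S m * ?H m * (\<Sum>n. R n * ?H n)) has_sum Z) UNIV"
  proof -
    have sum: "((\<lambda>((m, n), k). ?F (m - k) (n - k) k) has_sum Z) (SIGMA (m, n):UNIV \<times> UNIV. {..min m n})"
      by (rule iffD1[OF has_sum_reindex_bij_witness[where
            i = "\<lambda>((m, n), k). (m - k, n - k, k)" and j = "\<lambda>(i, j, k). ((i + k, j + k), k)"] Z]) auto
    have "((\<lambda>k. ?F (m - k) (n - k) k) has_sum S m * ?H m * (R n * ?H n)) {..min m n}" for m n
    proof (rule has_sum_finiteI)
      have "S m * ?H m * (R n * ?H n) = S m * R n * (?H m * ?H n)"
        by simp
      also have "\<dots> = (\<Sum>k\<le>min m n. ?F (m - k) (n - k) k)"
        unfolding linearisation[OF q] sum_distrib_left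
        by (rule sum.cong) (auto simp: prod_term_def)
      finally show "S m * ?H m * (R n * ?H n) = (\<Sum>k\<le>min m n. ?F (m - k) (n - k) k)" .
    qed simp
    then have sum: "((\<lambda>(m, n). S m * ?H m * (R n * ?H n)) has_sum Z) (UNIV \<times> UNIV)"
      by (intro has_sum_SigmaD[OF sum]) auto
    have "((\<lambda>n. R n * ?H n) has_sum (\<Sum>n. R n * ?H n)) UNIV"
      using geom_decay_series_summable[OF q x R]
      by (metis norm_summable_imp_has_sum summable_sums summable_norm_cancel)
    then show ?thesis
      by (intro has_sum_SigmaD[OF sum]) (auto intro!: has_sum_cmult_right)
  qed
  have "(\<lambda>m. S m * ?H m * (\<Sum>n. R n * ?H n)) sums ((\<Sum>m. S m * ?H m) * (\<Sum>n. R n * ?H n))"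
    by (intro sums_mult2 summable_sums summable_norm_cancel[OF geom_decay_series_summable[OF q x S]])
  with has_sum_imp_sums[OF 2] have "(\<Sum>m. S m * ?H m) * (\<Sum>n. R n * ?H n) = Z"
    by (rule sums_unique2[symmetric])
  with has_sum_imp_sums[OF 1] show ?thesis
    by (simp add: sums_unique)
qed

section \<open>Products of generating functions\<close>

lemma geom_decay_power:
  assumes "\<bar>t\<bar> < 1"
  shows "geom_decay (\<lambda>n. t ^ n)"
proof -
  define r where "r = (\<bar>t\<bar> + 1) / 2"
  have "\<bar>t ^ n\<bar> \<le> 1 * r ^ n" for n
    unfolding power_abs mult_1 by (rule power_mono) (use assms in \<open>simp_all add: r_def\<close>)
  moreover have "0 < r" "r < 1"
    using assms by (auto simp: r_def)
  ultimately show ?thesis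
    unfolding geom_decay_def using zero_less_one by blast
qed

lemma phi_h_eq_nherm: "phi_h q t x = (\<Sum>n. t ^ n * nherm q n x)"
  by (simp add: phi_h_def nherm_def)

text \<open>
  Using a multiset of parameters instead of a list is what makes the coefficients symmetric.
\<close>

lemma prod_phi_h_expansion:
  assumes q: "\<bar>q\<bar> < 1" and "\<forall>a\<in>#A. \<bar>a\<bar> < 1"
  shows "\<exists>c. geom_decay c \<and> (\<forall>x. \<bar>x\<bar> \<le> 1 \<longrightarrow>
    (\<Prod>a\<in>#A. phi_h q a x) = (\<Sum>l. c l * nherm q l x))"
  using assms(2)
proof (induction A)
  case empty
  \<comment> \<open>Since \<open>0\<^sup>0 = 1\<close>, these are the coefficients of the constant \<open>H\<^sub>0 = 1\<close>.\<close>
  have "geom_decay (\<lambda>n. 0 ^ n)"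
    by (rule geom_decay_power) simp
  moreover have "(\<Sum>l. 0 ^ l * nherm q l x) = 1" for x
    using suminf_finite[of "{0}" "\<lambda>l. 0 ^ l * nherm q l x"] by (simp add: power_0_left)
  ultimately show ?case by force
next
  case (add a A)
  then obtain c where c: "geom_decay c"
    "\<And>x. \<bar>x\<bar> \<le> 1 \<Longrightarrow> (\<Prod>a\<in>#A. phi_h q a x) = (\<Sum>l. c l * nherm q l x)"
    by auto
  have a: "geom_decay (\<lambda>n. a ^ n)"
    using add.prems by (intro geom_decay_power) simp
  show ?case
  proof (intro exI[of _ "prod_coeff q (\<lambda>n. a ^ n) c"] conjI allI impI)
    show "geom_decay (prod_coeff q (\<lambda>n. a ^ n) c)"
      by (rule prod_coeff_geom_decay[OF q a c(1)])
    fix x :: real assume "\<bar>x\<bar> \<le> 1"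
    then show "(\<Prod>a\<in>#add_mset a A. phi_h q a x) = (\<Sum>l. prod_coeff q (\<lambda>n. a ^ n) c l * nherm q l x)"
      by (simp add: c(2) phi_h_eq_nherm[of q a] series_product[OF q _ a c(1)])
  qed
qed

theorem lemma3:
  fixes q :: real and n :: nat
  assumes "-1 < q" and "q < 1"
  shows "\<exists>(A :: real list \<Rightarrow> real) (T :: nat \<Rightarrow> real list \<Rightarrow> real).
           symmetric_fun n A \<and> (\<forall>j. symmetric_fun n (T j)) \<and>
           (\<forall>a. length a = n \<and> (\<forall>k<n. \<bar>a ! k\<bar> < 1) \<longrightarrow>
              (\<forall>x. \<bar>x\<bar> \<le> 1 \<longrightarrow>
                 summable (\<lambda>j. T j a / qfac q j * qherm q j x) \<and>
                 g_n q a x = A a * f_h q x * (\<Sum>j. T j a / qfac q j * qherm q j x)) \<and>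
              summable (\<lambda>j. (T j a)\<^sup>2))"
proof -
  have q: "\<bar>q\<bar> < 1" using assms by auto
  have "\<forall>A\<in>{A. \<forall>t\<in>#A. \<bar>t\<bar> < 1}. \<exists>c. geom_decay c \<and> (\<forall>x. \<bar>x\<bar> \<le> 1 \<longrightarrow>
      (\<Prod>t\<in>#A. phi_h q t x) = (\<Sum>l. c l * nherm q l x))"
    using prod_phi_h_expansion[OF q] by simp
  from bchoice[OF this] obtain c where c: "\<And>A. \<forall>t\<in>#A. \<bar>t\<bar> < 1 \<Longrightarrow> geom_decay (c A)"
    "\<And>A x. \<forall>t\<in>#A. \<bar>t\<bar> < 1 \<Longrightarrow> \<bar>x\<bar> \<le> 1 \<Longrightarrow>
      (\<Prod>t\<in>#A. phi_h q t x) = (\<Sum>l. c A l * nherm q l x)"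
    by auto
  show ?thesis
  proof (intro exI[of _ "\<lambda>_. 1"] exI[of _ "\<lambda>j a. c (mset a) j"] conjI allI impI)
    fix a :: "real list"
    assume a: "length a = n \<and> (\<forall>k<n. \<bar>a ! k\<bar> < 1)"
    then have small: "\<forall>t\<in>#mset a. \<bar>t\<bar> < 1"
      by (auto simp: in_set_conv_nth)
    note decay = c(1)[OF small]
    show "summable (\<lambda>j. (c (mset a) j)\<^sup>2)"
      by (rule geom_decay_square_summable[OF decay])
    fix x :: real assume x: "\<bar>x\<bar> \<le> 1"
    have term_eq: "c (mset a) j / qfac q j * qherm q j x = c (mset a) j * nherm q j x" for j
      by (simp add: nherm_def)
    show "summable (\<lambda>j. c (mset a) j / qfac q j * qherm q j x)"
      unfolding term_eq by (rule summable_norm_cancel[OF geom_decay_series_summable[OF q x decay]])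
    have "(\<Prod>j<length a. phi_h q (a ! j) x) = (\<Prod>t\<leftarrow>a. phi_h q t x)"
      by (simp add: prod.list_conv_set_nth atLeast0LessThan)
    also have "\<dots> = (\<Prod>t\<in>#mset a. phi_h q t x)"
      by (metis mset_map prod_mset_prod_list)
    finally show "g_n q a x = 1 * f_h q x * (\<Sum>j. c (mset a) j / qfac q j * qherm q j x)"
      unfolding term_eq g_n_def by (simp add: c(2)[OF small x])
  qed (auto simp: symmetric_fun_def)
qed

end
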